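(* Let $(\mathfrak g,J_\pm,g)$ be a generalized Kähler Lie algebra of real dimension $2n$ and let $D$ be a flat connection on $\mathfrak g$ such that $Dg=0$, $DJ_+=0$ and $DJ_-=0$. Let $T_D\,\mathfrak g=\mathfrak g\ltimes_D\mathbb R^{2n}$ be the tangent Lie algebra determined by $D$, with the induced complex structures $\tilde J_\pm$ and inner product $\tilde g$. Then $(\tilde J_\pm,\tilde g)$ is a generalized Kähler structure on $T_D\,\mathfrak g$.
   Context: A complex structure on a real Lie algebra $\mathfrak g$ is a linear map $J:\mathfrak g\to\mathfrak g$ with $J^2=-\mathrm{Id}$ that is integrable, i.e. $J([X,Y]-[JX,JY])-([JX,Y]+[X,JY])=0$ for all $X,Y\in\mathfrak g$. An inner product $g$ is compatible with $J$ if $g(JX,JY)=g(X,Y)$ for all $X,Y$; the fundamental $2$-form is then $\omega(X,Y)=g(JX,Y)$. Let $d$ be the Chevalley--Eilenberg differential on $\Lambda^\bullet\mathfrak g^*$ (so $d\alpha(X,Y)=-\alpha([X,Y])$ for a $1$-form $\alpha$), extended to $\Lambda^\bullet\mathfrak g^*\otimes\mathbb C$, with $d=\partial+\overline\partial$ its decomposition according to the $(p,q)$-type defined by $J$. The Hermitian structure $(J,g)$ is SKT (strong Kähler with torsion) if $\partial\overline\partial\omega=0$; equivalently, if $dc=0$, where $c(X,Y,Z)=-d\omega(JX,JY,JZ)$ is the torsion $3$-form of the Bismut connection of $(J,g)$. A generalized Kähler Lie algebra $(\mathfrak g,J_\pm,g)$ is a Lie algebra with an inner product $g$ and a pair of complex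 structures $J_+,J_-$, both compatible with $g$, such that $(J_+,g)$ and $(J_-,g)$ are both SKT and $c_-=-c_+$, where $c_\pm$ is the torsion $3$-form of the Bismut connection of $(J_\pm,g)$. A connection on $\mathfrak g$ is a bilinear map $D:\mathfrak g\times\mathfrak g\to\mathfrak g$, $(X,Y)\mapsto D_XY$. It is flat if $D_XD_Y-D_YD_X=D_{[X,Y]}$ for all $X,Y$; $Dg=0$ means $g(D_XY,Z)=-g(Y,D_XZ)$ for all $X,Y,Z$; $DJ=0$ means $D_X(JY)=J(D_XY)$ for all $X,Y$. The tangent Lie algebra $T_D\,\mathfrak g=\mathfrak g\ltimes_D\mathbb R^{2n}$ is the vector space $\mathfrak g\oplus\mathfrak g$ (the second summand being the underlying vector space $\mathbb R^{2n}$ of $\mathfrak g$) with the bracket $$[(X_1,X_2),(Y_1,Y_2)]=([X_1,Y_1],\,D_{X_1}Y_2-D_{Y_1}X_2).$$ The induced structures are $\tilde J_\pm(X_1,X_2)=(J_\pm X_1,J_\pm X_2)$ and $\tilde g((X_1,X_2),(Y_1,Y_2))=g(X_1,Y_1)+g(X_2,Y_2)$. *)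

theory Defs
  imports "HOL-Analysis.Analysis"
begin

definition lie_algebra :: "('a::real_vector \<Rightarrow> 'a \<Rightarrow> 'a) \<Rightarrow> bool" where
  "lie_algebra br \<longleftrightarrow>
     (\<exists>B::'a set. finite B \<and> span B = UNIV) \<and>
     bilinear br \<and>
     (\<forall>X. br X X = 0) \<and>
     (\<forall>X Y Z. br X (br Y Z) + br Y (br Z X) + br Z (br X Y) = 0)"

definition inner_product :: "('a::real_vector \<Rightarrow> 'a \<Rightarrow> real) \<Rightarrow> bool" where
  "inner_product g \<longleftrightarrow>
     bilinear g \<and> (\<forall>X Y. g X Y = g Y X) \<and> (\<forall>X. X \<noteq> 0 \<longrightarrow> g X X > 0)"

definition complex_structure ::
    "('a::real_vector \<Rightarrow> 'a \<Rightarrow> 'a) \<Rightarrow> ('a \<Rightarrow> 'a) \<Rightarrow> bool" where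
  "complex_structure br J \<longleftrightarrow>
     linear J \<and> (\<forall>X. J (J X) = - X) \<and>
     (\<forall>X Y. J (br X Y - br (J X) (J Y)) - (br (J X) Y + br X (J Y)) = 0)"

definition compatible ::
    "('a::real_vector \<Rightarrow> 'a \<Rightarrow> real) \<Rightarrow> ('a \<Rightarrow> 'a) \<Rightarrow> bool" where
  "compatible g J \<longleftrightarrow> (\<forall>X Y. g (J X) (J Y) = g X Y)"


text \<open>
  A form is a function on argument lists: a \<open>k\<close>-form is used only through its
  values on lists of length \<open>k\<close>, and its values on other lists are irrelevant.
  Elements of the complexified exterior algebra are the complex-valued forms that are
  multilinear over the reals and alternating.
\<close>

type_synonym ('a, 'b) form = "'a list \<Rightarrow> 'b"

text \<open>
  The Chevalley-Eilenberg differential,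
  \[ d\alpha(X_0,\dots,X_k) = \sum_{i<j} (-1)^{i+j}
     \alpha([X_i,X_j],X_0,\dots,\widehat{X_i},\dots,\widehat{X_j},\dots,X_k). \]
\<close>

definition ce_d :: "('a \<Rightarrow> 'a \<Rightarrow> 'a) \<Rightarrow> ('a, 'b::ring_1) form \<Rightarrow> ('a, 'b) form" where
  "ce_d br \<alpha> xs =
     (\<Sum>j<length xs. \<Sum>i<j.
        (- 1) ^ (i + j) * \<alpha> (br (xs ! i) (xs ! j) # nths xs (- {i, j})))"

lemma ce_d_1: "ce_d br \<alpha> [X, Y] = - \<alpha> [br X Y]"
  by (simp add: ce_d_def nths_Cons)

lemma ce_d_2:
  "ce_d br \<alpha> [X, Y, Z] = - \<alpha> [br X Y, Z] + \<alpha> [br X Z, Y] - \<alpha> [br Y Z, X]"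
  by (simp add: ce_d_def nths_Cons lessThan_Suc)

text \<open>
  The complex-multilinear extension of a form to the complexified space, whose element
  \<open>X + \<i> Y\<close> is represented by the pair \<open>(X, Y)\<close>.
\<close>

fun cext :: "('a, complex) form \<Rightarrow> ('a \<times> 'a, complex) form" where
  "cext \<alpha> [] = \<alpha> []"
| "cext \<alpha> ((X, Y) # zs) =
     cext (\<lambda>xs. \<alpha> (X # xs)) zs + \<i> * cext (\<lambda>xs. \<alpha> (Y # xs)) zs"

text \<open>
  The projections \<open>(X - \<i> J X) / 2\<close> and \<open>(X + \<i> J X) / 2\<close> of \<open>X\<close> to the
  \<open>\<i>\<close>- and \<open>-\<i>\<close>-eigenspaces of \<open>J\<close>.
\<close>

definition proj10 :: "('a::real_vector \<Rightarrow> 'a) \<Rightarrow> 'a \<Rightarrow> 'a \<times> 'a" where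
  "proj10 J X = ((1/2) *\<^sub>R X, - ((1/2) *\<^sub>R J X))"

definition proj01 :: "('a::real_vector \<Rightarrow> 'a) \<Rightarrow> 'a \<Rightarrow> 'a \<times> 'a" where
  "proj01 J X = ((1/2) *\<^sub>R X, (1/2) *\<^sub>R J X)"

text \<open>
  The component of type \<open>(p, q)\<close> of a \<open>(p + q)\<close>-form. Expand \<open>\<alpha>\<close> at the arguments
  \<open>X = proj10 J X + proj01 J X\<close>; the component collects the terms in which exactly
  \<open>p\<close> arguments, those with index in \<open>S\<close>, have been projected to type \<open>(1,0)\<close>.
\<close>

definition type_part ::
    "('a::real_vector \<Rightarrow> 'a) \<Rightarrow> nat \<Rightarrow> nat \<Rightarrow> ('a, complex) form \<Rightarrow> ('a, complex) form" where
  "type_part J p q \<alpha> xs =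
     (if length xs = p + q
      then \<Sum>S | S \<subseteq> {..<p + q} \<and> card S = p.
             cext \<alpha> (map (\<lambda>i. if i \<in> S then proj10 J (xs ! i) else proj01 J (xs ! i)) [0..<p + q])
      else 0)"

text \<open>
  On the \<open>(p, q)\<close>-component, \<open>\<partial>\<close> is the part of type \<open>(p + 1, q)\<close> of \<open>d\<close>, and its
  conjugate the part of type \<open>(p, q + 1)\<close>. A list of length \<open>k + 1\<close> is an argument of
  the differential of a \<open>k\<close>-form, so the degree \<open>k = p + q\<close> is read off the list.
\<close>

definition ce_del ::
    "('a::real_vector \<Rightarrow> 'a \<Rightarrow> 'a) \<Rightarrow> ('a \<Rightarrow> 'a) \<Rightarrow> ('a, complex) form \<Rightarrow> ('a, complex) form" where
  "ce_del br J \<alpha> xs =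
     (case length xs of
        0 \<Rightarrow> 0
      | Suc k \<Rightarrow> \<Sum>p\<le>k. type_part J (Suc p) (k - p) (ce_d br (type_part J p (k - p) \<alpha>)) xs)"

definition ce_delbar ::
    "('a::real_vector \<Rightarrow> 'a \<Rightarrow> 'a) \<Rightarrow> ('a \<Rightarrow> 'a) \<Rightarrow> ('a, complex) form \<Rightarrow> ('a, complex) form" where
  "ce_delbar br J \<alpha> xs =
     (case length xs of
        0 \<Rightarrow> 0
      | Suc k \<Rightarrow> \<Sum>p\<le>k. type_part J p (Suc (k - p)) (ce_d br (type_part J p (k - p) \<alpha>)) xs)"


definition fundamental_form ::
    "('a \<Rightarrow> 'a \<Rightarrow> real) \<Rightarrow> ('a \<Rightarrow> 'a) \<Rightarrow> ('a, real) form" where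
  "fundamental_form g J xs = g (J (xs ! 0)) (xs ! 1)"

definition skt ::
    "('a::real_vector \<Rightarrow> 'a \<Rightarrow> 'a) \<Rightarrow> ('a \<Rightarrow> 'a) \<Rightarrow> ('a \<Rightarrow> 'a \<Rightarrow> real) \<Rightarrow> bool" where
  "skt br J g \<longleftrightarrow>
     (\<forall>X Y Z W. ce_del br J
        (ce_delbar br J (\<lambda>xs. complex_of_real (fundamental_form g J xs))) [X, Y, Z, W] = 0)"

text \<open>The torsion 3-form of the Bismut connection of \<open>(J, g)\<close>.\<close>

definition bismut_torsion ::
    "('a \<Rightarrow> 'a \<Rightarrow> 'a) \<Rightarrow> ('a \<Rightarrow> 'a) \<Rightarrow> ('a \<Rightarrow> 'a \<Rightarrow> real) \<Rightarrow> ('a, real) form" where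
  "bismut_torsion br J g xs = - ce_d br (fundamental_form g J) (map J xs)"

definition generalized_kaehler ::
    "('a::real_vector \<Rightarrow> 'a \<Rightarrow> 'a) \<Rightarrow> ('a \<Rightarrow> 'a) \<Rightarrow> ('a \<Rightarrow> 'a) \<Rightarrow> ('a \<Rightarrow> 'a \<Rightarrow> real) \<Rightarrow> bool" where
  "generalized_kaehler br Jp Jm g \<longleftrightarrow>
     lie_algebra br \<and> inner_product g \<and>
     complex_structure br Jp \<and> complex_structure br Jm \<and>
     compatible g Jp \<and> compatible g Jm \<and>
     skt br Jp g \<and> skt br Jm g \<and>
     (\<forall>X Y Z. bismut_torsion br Jm g [X, Y, Z] = - bismut_torsion br Jp g [X, Y, Z])"


definition flat_connection ::
    "('a::real_vector \<Rightarrow> 'a \<Rightarrow> 'a) \<Rightarrow> ('a \<Rightarrow> 'a \<Rightarrow> 'a) \<Rightarrow> bool" where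
  "flat_connection br D \<longleftrightarrow>
     bilinear D \<and> (\<forall>X Y Z. D X (D Y Z) - D Y (D X Z) = D (br X Y) Z)"

definition parallel_metric :: "('a \<Rightarrow> 'a \<Rightarrow> 'a) \<Rightarrow> ('a \<Rightarrow> 'a \<Rightarrow> real) \<Rightarrow> bool" where
  "parallel_metric D g \<longleftrightarrow> (\<forall>X Y Z. g (D X Y) Z = - g Y (D X Z))"

definition parallel_endo :: "('a \<Rightarrow> 'a \<Rightarrow> 'a) \<Rightarrow> ('a \<Rightarrow> 'a) \<Rightarrow> bool" where
  "parallel_endo D J \<longleftrightarrow> (\<forall>X Y. D X (J Y) = J (D X Y))"

definition tangent_bracket ::
    "('a::real_vector \<Rightarrow> 'a \<Rightarrow> 'a) \<Rightarrow> ('a \<Rightarrow> 'a \<Rightarrow> 'a) \<Rightarrow> 'a \<times> 'a \<Rightarrow> 'a \<times> 'a \<Rightarrow> 'a \<times> 'a" where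
  "tangent_bracket br D = (\<lambda>(X1, X2) (Y1, Y2). (br X1 Y1, D X1 Y2 - D Y1 X2))"

definition tangent_endo :: "('a \<Rightarrow> 'a) \<Rightarrow> 'a \<times> 'a \<Rightarrow> 'a \<times> 'a" where
  "tangent_endo J = (\<lambda>(X1, X2). (J X1, J X2))"

definition tangent_metric ::
    "('a \<Rightarrow> 'a \<Rightarrow> real) \<Rightarrow> 'a \<times> 'a \<Rightarrow> 'a \<times> 'a \<Rightarrow> real" where
  "tangent_metric g = (\<lambda>(X1, X2) (Y1, Y2). g X1 Y1 + g X2 Y2)"

end

theory Submission
  imports Defs
begin

text \<open>
  The projection \<open>fst\<close> of the tangent algebra onto \<open>\<gg>\<close> is a homomorphism of Lie algebras that
  commutes with the complex structures, so pulling back along it commutes with \<open>d\<close>, with the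
  type decomposition, and hence with \<open>\<partial>\<close> and its conjugate. Because \<open>D\<close> preserves \<open>g\<close> and
  \<open>J\<close>, the contribution of the second summand to the differential of the fundamental form
  cancels, and this differential is the pullback of the one on \<open>\<gg>\<close>. The fundamental forms are
  of type \<open>(1, 1)\<close>, so the pluriclosed condition and the torsion forms on the tangent algebra
  are pulled back from \<open>\<gg>\<close> as well.
\<close>

section \<open>Naturality of the differential and of the type decomposition\<close>

text \<open>Forms are functions on lists of every length, so agreement with the pullback is asked
  only in degree \<open>k\<close>: on a list of length \<open>Suc k\<close> the differential
  evaluates its form on lists of length \<open>k\<close> alone.\<close>

lemma ce_d_map:
  assumes f: "\<And>X Y. f (br' X Y) = br (f X) (f Y)"
    and \<beta>: "\<And>ys. length ys = k \<Longrightarrow> \<beta> ys = \<alpha> (map f ys)"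
    and len: "length xs = Suc k"
  shows "ce_d br' \<beta> xs = ce_d br \<alpha> (map f xs)"
proof -
  have "\<beta> (br' (xs ! i) (xs ! j) # nths xs (- {i, j})) =
      \<alpha> (br (map f xs ! i) (map f xs ! j) # nths (map f xs) (- {i, j}))"
    if ij: "j < length xs" "i < j" for i j
  proof -
    \<comment> \<open>The indices \<open>i < j\<close> are distinct, so deleting both drops exactly
      two entries, and the bracket put in front restores length \<open>k\<close>.\<close>
    have "{l. l < length xs \<and> l \<in> - {i, j}} = {..<length xs} - {i, j}"
      by auto
    moreover have "card ({..<length xs} - {i, j}) = length xs - 2"
      using ij by (subst card_Diff_subset) auto
    ultimately have "length (nths xs (- {i, j})) = length xs - 2"
      by (simp add: length_nths)
    then have "length (br' (xs ! i) (xs ! j) # nths xs (- {i, j})) = k"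
      using ij len by simp
    from \<beta>[OF this] show ?thesis
      using ij by (simp add: f nths_map)
  qed
  then show ?thesis
    by (simp add: ce_d_def)
qed

lemma ce_d_cong:
  assumes "\<And>ys. length ys = k \<Longrightarrow> \<beta> ys = \<alpha> ys" "length xs = Suc k"
  shows "ce_d br \<beta> xs = ce_d br \<alpha> xs"
  using ce_d_map[of id br br k \<beta> \<alpha> xs] assms by simp

lemma cext_map:
  assumes "\<And>ys. length ys = length zs \<Longrightarrow> \<beta> ys = \<alpha> (map f ys)"
  shows "cext \<beta> zs = cext \<alpha> (map (map_prod f f) zs)"
  using assms
\<comment> \<open>\<open>cext\<close> feeds arguments into the form one at a time, so both forms
  change along the recursion.\<close>
proof (induction zs arbitrary: \<alpha> \<beta>)
  case (Cons z zs)
  obtain X Y where z: "z = (X, Y)"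
    by (cases z)
  have "cext (\<lambda>xs. \<beta> (U # xs)) zs = cext (\<lambda>xs. \<alpha> (f U # xs)) (map (map_prod f f) zs)" for U
    using Cons.prems by (intro Cons.IH) simp
  then show ?case
    by (simp add: z)
qed simp

text \<open>A linear map intertwining \<open>J'\<close> and \<open>J\<close> extends
  complex-linearly to one that respects the eigenspaces, hence commutes with both projections; the
  summands then agree for each \<open>S\<close> separately.\<close>

lemma type_part_map:
  assumes f: "linear f" "\<And>X. f (J' X) = J (f X)"
    and \<beta>: "\<And>ys. length ys = p + q \<Longrightarrow> \<beta> ys = \<alpha> (map f ys)"
  shows "type_part J' p q \<beta> xs = type_part J p q \<alpha> (map f xs)"
proof (cases "length xs = p + q")
  case True
  have proj: "map_prod f f (proj10 J' X) = proj10 J (f X)"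
    "map_prod f f (proj01 J' X) = proj01 J (f X)" for X
    by (simp_all add: proj10_def proj01_def f linear_scale linear_neg)
  have "cext \<beta> (map (\<lambda>i. if i \<in> S then proj10 J' (xs ! i) else proj01 J' (xs ! i)) [0..<p + q]) =
      cext \<alpha> (map (\<lambda>i. if i \<in> S then proj10 J (map f xs ! i) else proj01 J (map f xs ! i))
        [0..<p + q])" for S
    by (subst cext_map[of _ \<beta> \<alpha> f])
      (use True in \<open>auto simp: \<beta> proj intro!: arg_cong[of _ _ "cext \<alpha>"]\<close>)
  with True show ?thesis
    by (simp add: type_part_def)
qed (simp add: type_part_def)

lemma ce_del_map:
  assumes f: "linear f" "\<And>X. f (J' X) = J (f X)" "\<And>X Y. f (br' X Y) = br (f X) (f Y)"
    and \<beta>: "\<And>ys. length ys = k \<Longrightarrow> \<beta> ys = \<alpha> (map f ys)"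
    and len: "length xs = Suc k"
  shows "ce_del br' J' \<beta> xs = ce_del br J \<alpha> (map f xs)"
proof -
  have "type_part J' (Suc p) (k - p) (ce_d br' (type_part J' p (k - p) \<beta>)) xs =
      type_part J (Suc p) (k - p) (ce_d br (type_part J p (k - p) \<alpha>)) (map f xs)"
    if "p \<le> k" for p
    using that
    by (intro type_part_map ce_d_map[where k = k] f) (auto simp: \<beta>)
  then show ?thesis
    by (simp add: ce_del_def len)
qed

section \<open>Type of the fundamental form\<close>

text \<open>Compatibility makes the form \<open>J\<close>-invariant, whereas on two vectors of the
  same eigenspace applying \<open>J\<close> multiplies it by -1, so only type (1,1) survives. This
  collapses the sum over types in \<open>ce_delbar\<close>.\<close>

lemma fundamental_form_type:
  assumes g: "bilinear g" and J: "linear J" "\<And>X. J (J X) = - X" and "compatible g J"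
    and "p \<le> 2" "length xs = 2"
  shows "type_part J p (2 - p) (\<lambda>xs. complex_of_real (fundamental_form g J xs)) xs =
    (if p = 1 then complex_of_real (fundamental_form g J xs) else 0)"
proof -
  obtain X Y where xs: "xs = [X, Y]"
    using \<open>length xs = 2\<close> by (auto simp: length_Suc_conv numeral_2_eq_2)
  \<comment> \<open>Listing the four subsets of the two indices makes the sums over \<open>S\<close>
    explicit.\<close>
  have "{..<2} = insert 0 {1::nat}"
    by auto
  then have "S \<subseteq> {..<2} \<longleftrightarrow> S \<in> Pow (insert 0 {1})" for S :: "nat set"
    by simp
  also have "Pow (insert 0 {1}) = {{}, {0}, {1}, {0, 1::nat}}"
    unfolding Pow_insert Pow_empty by auto
  finally have subsets: "S \<subseteq> {..<2} \<longleftrightarrow> S \<in> {{}, {0}, {1}, {0, 1}}" for S :: "nat set" .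
  have sets: "{S. S \<subseteq> {..<2} \<and> card S = 0} = {{}::nat set}"
    "{S. S \<subseteq> {..<2} \<and> card S = 1} = {{0}, {1::nat}}"
    "{S. S \<subseteq> {..<2} \<and> card S = 2} = {{0, 1::nat}}"
    unfolding subsets by auto
  have gJ: "g (J U) (J V) = g U V" for U V
    using \<open>compatible g J\<close> by (simp add: compatible_def)
  \<comment> \<open>Compatibility at \<open>U\<close> and \<open>J V\<close>, with \<open>J\<close>
    squaring to -1, shows that \<open>J\<close> is skew for \<open>g\<close>.\<close>
  have gJ': "g U (J V) = - g (J U) V" for U V
    using gJ[of U "J V"] by (simp add: J bilinear_rneg[OF g])
  have upt: "[0..<2] = [0, 1]"
    by (simp add: upt_rec)
  \<comment> \<open>Subtraction on naturals is truncated, so the first equation rests on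
    \<open>p \<le> 2\<close>.\<close>
  have "p + (2 - p) = 2" "length xs = 2" "xs ! 0 = X" "xs ! 1 = Y"
    using \<open>p \<le> 2\<close> xs by simp_all
  then have expand: "type_part J p (2 - p) (\<lambda>xs. complex_of_real (fundamental_form g J xs)) xs =
      (\<Sum>S | S \<subseteq> {..<2::nat} \<and> card S = p. cext (\<lambda>xs. complex_of_real (fundamental_form g J xs))
        [if 0 \<in> S then proj10 J X else proj01 J X, if 1 \<in> S then proj10 J Y else proj01 J Y])"
    unfolding type_part_def by (simp only: simp_thms if_True upt list.map)
  note simps = fundamental_form_def xs proj10_def proj01_def
    linear_scale[OF J(1)] linear_neg[OF J(1)] J(2) gJ gJ'
    bilinear_lmul[OF g] bilinear_rmul[OF g] bilinear_lneg[OF g] bilinear_rneg[OF g]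
  consider "p = 0" | "p = 1" | "p = 2"
    using \<open>p \<le> 2\<close> by linarith
  then show ?thesis
  proof cases
    case 1
    show ?thesis
      unfolding expand unfolding 1 sets by (simp add: simps algebra_simps)
  next
    case 2
    show ?thesis
      unfolding expand unfolding 2 sets by (simp add: simps algebra_simps)
  next
    case 3
    show ?thesis
      unfolding expand unfolding 3 sets by (simp add: simps algebra_simps)
  qed
qed

section \<open>The tangent algebra\<close>

lemma tangent_bracket_simp [simp]:
  "tangent_bracket br D (X1, X2) (Y1, Y2) = (br X1 Y1, D X1 Y2 - D Y1 X2)"
  by (simp add: tangent_bracket_def)

lemma tangent_endo_simp [simp]: "tangent_endo J (X1, X2) = (J X1, J X2)"
  by (simp add: tangent_endo_def)

lemma tangent_metric_simp [simp]:
  "tangent_metric g (X1, X2) (Y1, Y2) = g X1 Y1 + g X2 Y2"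
  by (simp add: tangent_metric_def)

lemmas bilinear_simps =
  bilinear_ladd bilinear_radd bilinear_lsub bilinear_rsub bilinear_lneg bilinear_rneg
  bilinear_lmul bilinear_rmul bilinear_lzero bilinear_rzero

lemma fst_tangent_bracket: "fst (tangent_bracket br D X Y) = br (fst X) (fst Y)"
  by (cases X; cases Y) simp

lemma fst_tangent_endo: "fst (tangent_endo J X) = J (fst X)"
  by (cases X) simp

lemma linear_tangent_endo:
  assumes "linear J"
  shows "linear (tangent_endo J)"
  by (rule linearI) (auto simp: linear_add[OF assms] linear_scale[OF assms])

text \<open>Flatness makes \<open>D\<close> a representation, which yields the Jacobi identity in
  the second component; the first component is the identity for \<open>br\<close>.\<close>

lemma lie_algebra_tangent:
  assumes "lie_algebra br" "flat_connection br D"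
  shows "lie_algebra (tangent_bracket br D)"
proof -
  obtain B :: "'a set" where B: "finite B" "span B = UNIV"
    using assms by (auto simp: lie_algebra_def)
  have br: "bilinear br" and alt: "\<And>X. br X X = 0"
    and jacobi: "\<And>X Y Z. br X (br Y Z) + br Y (br Z X) + br Z (br X Y) = 0"
    using assms by (auto simp: lie_algebra_def)
  have D: "bilinear D" and flat: "\<And>X Y Z. D (br X Y) Z = D X (D Y Z) - D Y (D X Z)"
    using assms by (auto simp: flat_connection_def)
  have "span (B \<times> {0} \<union> {0} \<times> B) = (UNIV :: ('a \<times> 'a) set)"
  proof -
    have "(X, 0) \<in> span (B \<times> {0} \<union> {0} \<times> B)" for X :: 'a
    proof -
      have "(X, 0) \<in> (\<lambda>X. (X, 0::'a)) ` span B"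
        using B by simp
      also have "\<dots> = span ((\<lambda>X. (X, 0)) ` B)"
        by (intro linear_span_image[symmetric] linearI) auto
      also have "\<dots> \<subseteq> span (B \<times> {0} \<union> {0} \<times> B)"
        by (intro span_mono) auto
      finally show ?thesis .
    qed
    moreover have "(0, X) \<in> span (B \<times> {0} \<union> {0} \<times> B)" for X :: 'a
    proof -
      have "(0, X) \<in> (\<lambda>X. (0::'a, X)) ` span B"
        using B by simp
      also have "\<dots> = span ((\<lambda>X. (0, X)) ` B)"
        by (intro linear_span_image[symmetric] linearI) auto
      also have "\<dots> \<subseteq> span (B \<times> {0} \<union> {0} \<times> B)"
        by (intro span_mono) auto
      finally show ?thesis .
    qed
    ultimately have "(X, 0) + (0, Y) \<in> span (B \<times> {0} \<union> {0} \<times> B)" for X Y :: 'a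
      by (intro span_add)
    then show ?thesis
      by auto
  qed
  moreover have "finite (B \<times> {0} \<union> {0} \<times> B)"
    using B by simp
  moreover have "bilinear (tangent_bracket br D)"
    unfolding bilinear_def
    by (auto intro!: linearI
        simp: bilinear_simps[OF br] bilinear_simps[OF D] algebra_simps)
  moreover have "tangent_bracket br D X X = 0" for X
    by (cases X) (simp add: alt zero_prod_def)
  moreover have "tangent_bracket br D X (tangent_bracket br D Y Z) +
      tangent_bracket br D Y (tangent_bracket br D Z X) +
      tangent_bracket br D Z (tangent_bracket br D X Y) = 0" for X Y Z
    by (cases X; cases Y; cases Z)
      (simp add: jacobi flat bilinear_simps[OF D] zero_prod_def)
  ultimately show ?thesis
    unfolding lie_algebra_def by blast
qed

lemma inner_product_tangent:
  assumes "inner_product g"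
  shows "inner_product (tangent_metric g)"
proof -
  have g: "bilinear g" and sym: "\<And>X Y. g X Y = g Y X" and pos: "\<And>X. X \<noteq> 0 \<Longrightarrow> g X X > 0"
    using assms by (auto simp: inner_product_def)
  \<comment> \<open>A nonzero pair may have one zero component, whose contribution must then be
    known to be nonnegative.\<close>
  have nonneg: "g X X \<ge> 0" for X
    using pos[of X] by (cases "X = 0") (auto simp: bilinear_simps[OF g])
  have "bilinear (tangent_metric g)"
    unfolding bilinear_def
    by (auto intro!: linearI simp: bilinear_simps[OF g] algebra_simps)
  moreover have "tangent_metric g X Y = tangent_metric g Y X" for X Y
    by (cases X; cases Y) (simp add: sym)
  moreover have "tangent_metric g X X > 0" if "X \<noteq> 0" for X
    using that
    by (cases X) (auto simp: zero_prod_def intro: add_pos_nonneg add_nonneg_pos pos nonneg)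
  ultimately show ?thesis
    by (simp add: inner_product_def)
qed

text \<open>In the second component of the integrability expression, moving \<open>J\<close> past
  \<open>D\<close> makes the terms cancel in pairs; the first component is integrability of
  \<open>J\<close>.\<close>

lemma complex_structure_tangent:
  assumes "complex_structure br J" "bilinear D" "parallel_endo D J"
  shows "complex_structure (tangent_bracket br D) (tangent_endo J)"
proof -
  have J: "linear J" "\<And>X. J (J X) = - X"
    and int: "\<And>X Y. J (br X Y - br (J X) (J Y)) - (br (J X) Y + br X (J Y)) = 0"
    using assms by (auto simp: complex_structure_def)
  have DJ: "D X (J Y) = J (D X Y)" for X Y
    using assms by (simp add: parallel_endo_def)
  have "tangent_endo J (tangent_bracket br D X Y -
        tangent_bracket br D (tangent_endo J X) (tangent_endo J Y)) -
      (tangent_bracket br D (tangent_endo J X) Y + tangent_bracket br D X (tangent_endo J Y)) = 0"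
    for X Y
    by (cases X; cases Y)
      (use int in \<open>simp add: DJ J linear_diff[OF J(1)] linear_neg[OF J(1)] zero_prod_def\<close>)
  moreover have "tangent_endo J (tangent_endo J X) = - X" for X
    by (cases X) (simp add: J)
  ultimately show ?thesis
    using linear_tangent_endo[OF J(1)] by (simp add: complex_structure_def)
qed

lemma compatible_tangent:
  assumes "compatible g J"
  shows "compatible (tangent_metric g) (tangent_endo J)"
  using assms by (simp add: compatible_def split_paired_all)

text \<open>The form also pairs second components, so in general it is not itself a pullback; the
  comparison starts only after applying the differential.\<close>

lemma ce_d_fundamental_form_tangent:
  assumes g: "inner_product g" and J: "complex_structure br J" "compatible g J"
    and D: "parallel_metric D g" "parallel_endo D J"
    and len: "length xs = 3"
  shows "ce_d (tangent_bracket br D) (fundamental_form (tangent_metric g) (tangent_endo J)) xs =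
    ce_d br (fundamental_form g J) (map fst xs)"
proof -
  have bil: "bilinear g" and sym: "\<And>X Y. g X Y = g Y X"
    using g by (auto simp: inner_product_def)
  have lin: "linear J" and JJ: "\<And>X. J (J X) = - X"
    using J by (auto simp: complex_structure_def)
  \<comment> \<open>\<open>D\<^sub>X\<close> is skew for \<open>g\<close> and commutes with \<open>J\<close>, so \<open>\<omega>(D\<^sub>X Y, Z)\<close> is symmetric in \<open>Y\<close> and \<open>Z\<close>.\<close>
  have swap: "g (J (D X Y)) Z = g (J (D X Z)) Y" for X Y Z
  proof -
    have "g (J (D X Y)) Z = g (J (J (D X Y))) (J Z)"
      using J by (simp add: compatible_def)
    also have "\<dots> = - g (D X Y) (J Z)"
      by (simp add: JJ bilinear_lneg[OF bil])
    also have "\<dots> = g Y (D X (J Z))"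
      using D by (simp add: parallel_metric_def)
    also have "\<dots> = g (J (D X Z)) Y"
      using D sym by (simp add: parallel_endo_def)
    finally show ?thesis .
  qed
  obtain X Y Z where xs: "xs = [X, Y, Z]"
    using len by (auto simp: length_Suc_conv numeral_3_eq_3)
  obtain X1 X2 Y1 Y2 Z1 Z2 where "X = (X1, X2)" "Y = (Y1, Y2)" "Z = (Z1, Z2)"
    by (cases X; cases Y; cases Z)
  \<comment> \<open>Each first component acts through \<open>D\<close> on the second components of
    the other two arguments; one instance of \<open>swap\<close> cancels each such pair of
    terms.\<close>
  then show ?thesis
    using swap[of X1 Y2 Z2] swap[of Y1 X2 Z2] swap[of Z1 X2 Y2]
    by (simp add: xs ce_d_2 fundamental_form_def linear_diff[OF lin] bilinear_simps[OF bil])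
qed

lemma ce_d_of_real: "ce_d br (\<lambda>xs. of_real (\<alpha> xs)) xs = of_real (ce_d br \<alpha> xs)"
  by (simp add: ce_d_def)

text \<open>Naturality cannot start from the fundamental forms, so their type components are
  evaluated on both algebras first, then the differentials are compared, and only the outer type
  projection is pulled back by \<open>type_part_map\<close>.\<close>

lemma ce_delbar_fundamental_form_tangent:
  fixes J :: "'a::real_vector \<Rightarrow> 'a"
  assumes g: "inner_product g" and J: "complex_structure br J" "compatible g J"
    and D: "bilinear D" "parallel_metric D g" "parallel_endo D J"
    and len: "length xs = 3"
  shows "ce_delbar (tangent_bracket br D) (tangent_endo J)
      (\<lambda>xs. complex_of_real (fundamental_form (tangent_metric g) (tangent_endo J) xs)) xs =
    ce_delbar br J (\<lambda>xs. complex_of_real (fundamental_form g J xs)) (map fst xs)"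
proof -
  define \<omega> where "\<omega> = (\<lambda>xs. complex_of_real (fundamental_form g J xs))"
  define \<omega>' where
    "\<omega>' = (\<lambda>xs. complex_of_real (fundamental_form (tangent_metric g) (tangent_endo J) xs))"
  have type: "type_part J p (2 - p) \<omega> ys = (if p = 1 then \<omega> ys else 0)"
    if "p \<le> 2" "length ys = 2" for p ys
    unfolding \<omega>_def
    by (rule fundamental_form_type)
      (use g J that in \<open>auto simp: inner_product_def complex_structure_def\<close>)
  have type': "type_part (tangent_endo J) p (2 - p) \<omega>' ys = (if p = 1 then \<omega>' ys else 0)"
    if "p \<le> 2" "length ys = 2" for p ys
    unfolding \<omega>'_def
    by (rule fundamental_form_type)
      (use inner_product_tangent[OF g] complex_structure_tangent[OF J(1) D(1) D(3)]
          compatible_tangent[OF J(2)] that in \<open>auto simp: inner_product_def complex_structure_def\<close>)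
  have d: "ce_d (tangent_bracket br D) (type_part (tangent_endo J) p (2 - p) \<omega>') ys =
      ce_d br (type_part J p (2 - p) \<omega>) (map fst ys)"
    if "p \<le> 2" "length ys = 3" for p ys
  proof -
    have "ce_d (tangent_bracket br D) (type_part (tangent_endo J) p (2 - p) \<omega>') ys =
        ce_d (tangent_bracket br D) (\<lambda>zs. if p = 1 then \<omega>' zs else 0) ys"
      by (rule ce_d_cong[where k = 2]) (use type' that in auto)
    also have "\<dots> = ce_d br (\<lambda>zs. if p = 1 then \<omega> zs else 0) (map fst ys)"
    \<comment> \<open>For other values of \<open>p\<close> both forms are zero.\<close>
    proof (cases "p = 1")
      case True
      then show ?thesis
        using ce_d_fundamental_form_tangent[OF g J D(2,3) that(2)]
        by (simp add: \<omega>_def \<omega>'_def ce_d_of_real)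
    qed (simp add: ce_d_def)
    also have "\<dots> = ce_d br (type_part J p (2 - p) \<omega>) (map fst ys)"
      by (rule ce_d_cong[where k = 2]) (use type that in auto)
    finally show ?thesis .
  qed
  have "type_part (tangent_endo J) p (Suc (2 - p))
        (ce_d (tangent_bracket br D) (type_part (tangent_endo J) p (2 - p) \<omega>')) xs =
      type_part J p (Suc (2 - p)) (ce_d br (type_part J p (2 - p) \<omega>)) (map fst xs)"
    if "p \<le> 2" for p
    using that by (intro type_part_map linear_fst fst_tangent_endo d) auto
  \<comment> \<open>Written as a successor to match the case distinction in
    \<open>ce_delbar\<close>.\<close>
  moreover have "length xs = Suc 2"
    using len by simp
  ultimately have "ce_delbar (tangent_bracket br D) (tangent_endo J) \<omega>' xs =
      ce_delbar br J \<omega> (map fst xs)"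
    unfolding ce_delbar_def length_map by (auto simp only: nat.case atMost_iff intro!: sum.cong)
  then show ?thesis
    by (simp only: \<omega>_def \<omega>'_def)
qed

text \<open>Unlike the fundamental form, its \<open>ce_delbar\<close> is a pullback in degree 3, so
  \<open>ce_del_map\<close> carries the vanishing over.\<close>

lemma skt_tangent:
  assumes "skt br J g"
    and g: "inner_product g" and J: "complex_structure br J" "compatible g J"
    and D: "bilinear D" "parallel_metric D g" "parallel_endo D J"
  shows "skt (tangent_bracket br D) (tangent_endo J) (tangent_metric g)"
  unfolding skt_def
proof (intro allI)
  fix X Y Z W :: "'a \<times> 'a"
  have "ce_del (tangent_bracket br D) (tangent_endo J)
      (ce_delbar (tangent_bracket br D) (tangent_endo J)
        (\<lambda>xs. complex_of_real (fundamental_form (tangent_metric g) (tangent_endo J) xs)))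
      [X, Y, Z, W] =
    ce_del br J (ce_delbar br J (\<lambda>xs. complex_of_real (fundamental_form g J xs)))
      (map fst [X, Y, Z, W])"
    by (rule ce_del_map[where k = 3])
      (simp_all add: linear_fst fst_tangent_endo fst_tangent_bracket
        ce_delbar_fundamental_form_tangent[OF g J D])
  then show "ce_del (tangent_bracket br D) (tangent_endo J)
      (ce_delbar (tangent_bracket br D) (tangent_endo J)
        (\<lambda>xs. complex_of_real (fundamental_form (tangent_metric g) (tangent_endo J) xs)))
      [X, Y, Z, W] = 0"
    using \<open>skt br J g\<close> by (simp add: skt_def)
qed

lemma bismut_torsion_tangent:
  assumes "inner_product g" "complex_structure br J" "compatible g J"
    and "parallel_metric D g" "parallel_endo D J"
    and "length xs = 3"
  shows "bismut_torsion (tangent_bracket br D) (tangent_endo J) (tangent_metric g) xs =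
    bismut_torsion br J g (map fst xs)"
  using assms
  by (simp add: bismut_torsion_def ce_d_fundamental_form_tangent fst_tangent_endo o_def)

theorem corollary3p3:
  fixes br :: "'a::real_vector \<Rightarrow> 'a \<Rightarrow> 'a"
    and Jp Jm :: "'a \<Rightarrow> 'a"
    and g :: "'a \<Rightarrow> 'a \<Rightarrow> real"
    and D :: "'a \<Rightarrow> 'a \<Rightarrow> 'a"
    and n :: nat
  assumes "generalized_kaehler br Jp Jm g"
    and "dim (UNIV :: 'a set) = 2 * n"
    and "flat_connection br D"
    and "parallel_metric D g"
    and "parallel_endo D Jp"
    and "parallel_endo D Jm"
  shows "generalized_kaehler (tangent_bracket br D)
           (tangent_endo Jp) (tangent_endo Jm) (tangent_metric g)"
proof -
  \<comment> \<open>Extracted from flatness as a side condition of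
    \<open>complex_structure_tangent\<close> and \<open>skt_tangent\<close>.\<close>
  have "bilinear D"
    using assms by (simp add: flat_connection_def)
  with assms show ?thesis
    by (simp add: generalized_kaehler_def lie_algebra_tangent inner_product_tangent
        complex_structure_tangent compatible_tangent skt_tangent bismut_torsion_tangent)
qed

end
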